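(* Let $\mathcal{S}=\langle\mathcal{L},\vdash_\gamma\rangle$ and $\mathcal{T}=\langle\mathcal{L}',\vdash_\delta\rangle$ be two propositional deductive systems, with domains $S$ and $T$. If $\mathcal{S}$ and $\mathcal{T}$ are equivalent, then there exist two quantale homomorphisms $\overline{\tau}:\wp(\mathbf{\Sigma}_{\mathcal{L}})\to\wp(\mathbf{\Sigma}_{\mathcal{L}'})$ and $\overline{\tau}':\wp(\mathbf{\Sigma}_{\mathcal{L}'})\to\wp(\mathbf{\Sigma}_{\mathcal{L}})$, and $\wp(\mathbf{S})_\gamma$ and $\wp(\mathbf{T})_\delta$ are isomorphic both as $\wp(\mathbf{\Sigma}_{\mathcal{L}})$-modules (with $\wp(\mathbf{T})_\delta$ regarded as a $\wp(\mathbf{\Sigma}_{\mathcal{L}})$-module via $\overline{\tau}$) and as $\wp(\mathbf{\Sigma}_{\mathcal{L}'})$-modules (with $\wp(\mathbf{S})_\gamma$ regarded as a $\wp(\mathbf{\Sigma}_{\mathcal{L}'})$-module via $\overline{\tau}'$).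
   Context: A propositional language is $\mathcal{L}=\langle L,\nu\rangle$ with $L$ a set of connectives and $\nu:L\to\mathbb{N}_0$ the arity. Fix a denumerable set $V$ of variables common to all languages. $\mathit{Fm}_{\mathcal{L}}$ is the set of $\mathcal{L}$-formulas. A substitution is a map $V\to\mathit{Fm}_{\mathcal{L}}$ extended to formulas; $\mathbf{\Sigma}_{\mathcal{L}}$ is the monoid of substitutions under composition; $\wp(\mathbf{\Sigma}_{\mathcal{L}})$ is the quantale of sets of substitutions (join = union, complex product $\Sigma_1\cdot\Sigma_2=\{\sigma_1\circ\sigma_2\}$, unit $\{\mathrm{id}\}$). A sequent of type $(m,n)$ is a pair of sequences of $\mathcal{L}$-formulas of lengths $m$ and $n$ (not both zero). A set of sequents is assumed closed under type. Formulas are identified with $(0,1)$-sequents, equations with $(1,1)$-sequents. A deductive system $\mathcal{S}=\langle\mathcal{L},\vdash_\gamma\rangle$ has as domain a set $S$ of sequents over $\mathcal{L}$ closed under type, with a finitary, substitution-invariant consequence relation $\vdash_\gamma$ on $\wp(S)$: $\Psi\subseteq\Phi$ implies $\Phi\vdash\Psi$; $\vdash$ is transitive; $\Phi\vdash\bigcup_{\Phi\vdash\Psi}\Psi$; if $\Phi\vdash\Psi$ with $\Psi$ finite then $\Phi_0\vdash\Psi$ for some finite $\Phi_0\subseteq\Phi$; $\Phi\vdash\Psi$ implies $\sigma[\Phi]\vdash\sigma[\Psi]$. The associated closure operator is $\gamma(\Phi)=\bigcup\{\Psi\mid\Phi\vdash_\gamma\Psi\}$. $\Phi\dashv\vdash_\gamma\Psi$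 means $\Phi\vdash_\gamma\Psi$ and $\Psi\vdash_\gamma\Phi$. $\wp(\mathbf{S})$ is the $\wp(\mathbf{\Sigma}_{\mathcal{L}})$-module of subsets of $S$ with $\Sigma\star\Phi=\{\sigma(\varphi)\mid\sigma\in\Sigma,\varphi\in\Phi\}$. $\wp(\mathbf{S})_\gamma$ is the module $\{\gamma(\Phi)\mid\Phi\subseteq S\}$ with join $\gamma(\bigcup_i\Phi_i)$ and scalar multiplication $\Sigma\star_\gamma\Phi=\gamma(\Sigma\star\Phi)$; similarly $\wp(\mathbf{T})_\delta$. An $\mathbf{R}$-module becomes a $\mathbf{Q}$-module via a quantale homomorphism $h:\mathbf{Q}\to\mathbf{R}$ by $q\star_hx=h(q)\star x$. Language translation: a derived connective in $\mathcal{L}'$ of arity $n$ is a map $(\psi_1,\dots,\psi_n)\mapsto\varphi(x_1/\psi_1,\dots,x_n/\psi_n)$ for some $\mathcal{L}'$-formula $\varphi(x_1,\dots,x_n)$. Given for each $f\in L$ a derived connective $f'$ in $\mathcal{L}'$ of arity $\nu(f)$, $\tau:\mathit{Fm}_{\mathcal{L}}\to\mathit{Fm}_{\mathcal{L}'}$ is a language translation if $\tau^{-1}(x)=\{x\}$ for every variable $x$ and $\tau(f(\varphi_1,\dots,\varphi_{\nu(f)}))=f'(\tau(\varphi_1),\dots,\tau(\varphi_{\nu(f)}))$. It induces the quantale homomorphism $\overline{\tau}:\wp(\mathbf{\Sigma}_{\mathcal{L}})\to\wp(\mathbf{\Sigma}_{\mathcal{L}'})$, the elementwise extension of the map sending $\sigma$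 to the substitution whose restriction to $V$ is $\tau\circ\sigma_{\restriction V}$. A faithful interpretation $\iota:\mathcal{S}\to\mathcal{T}$ is a map $\iota:\wp(S)\to\wp(T)$ preserving arbitrary unions for which there is a language translation $\tau$ of $\mathcal{L}$ into $\mathcal{L}'$ such that, for all $\Phi,\Psi\subseteq S$ and sets $\Sigma$ of substitutions over $\mathcal{L}$: $\Phi\vdash_\gamma\Psi$ iff $\iota(\Phi)\vdash_\delta\iota(\Psi)$; and $\iota(\Sigma\star\Phi)=\overline{\tau}(\Sigma)\star\iota(\Phi)$. $\mathcal{S}$ and $\mathcal{T}$ are equivalent if there are faithful interpretations $\iota:\mathcal{S}\to\mathcal{T}$ and $\iota':\mathcal{T}\to\mathcal{S}$ with $\Phi\dashv\vdash_\gamma(\iota'\circ\iota)(\Phi)$ for all $\Phi\in\wp(S)$. *)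

theory Defs
  imports "HOL-Algebra.Coset" "HOL-Algebra.Complete_Lattice"
begin

section \<open>Quantales and their modules\<close>

text \<open>
  Complete lattices are those of \<open>HOL-Algebra\<close>, with the operation of arbitrary
  joins as an explicit part of the structure.
\<close>

record 'a sup_lattice = "'a gorder" +
  Join :: "'a set \<Rightarrow> 'a"

locale sup_lattice = complete_lattice L
  for L :: "('a, 'm) sup_lattice_scheme" (structure) +
  assumes Join_lub: "A \<subseteq> carrier L \<Longrightarrow> is_lub L (Join L A) A"

record 'a quantale = "'a sup_lattice" +
  qmult :: "'a \<Rightarrow> 'a \<Rightarrow> 'a"
  qone :: 'a

locale quantale = sup_lattice Q
  for Q :: "('a, 'm) quantale_scheme" +
  assumes qmult_closed:
      "\<lbrakk>a \<in> carrier Q; b \<in> carrier Q\<rbrakk> \<Longrightarrow> qmult Q a b \<in> carrier Q"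
    and qone_closed: "qone Q \<in> carrier Q"
    and qmult_assoc:
      "\<lbrakk>a \<in> carrier Q; b \<in> carrier Q; c \<in> carrier Q\<rbrakk>
        \<Longrightarrow> qmult Q (qmult Q a b) c = qmult Q a (qmult Q b c)"
    and qone_left: "a \<in> carrier Q \<Longrightarrow> qmult Q (qone Q) a = a"
    and qone_right: "a \<in> carrier Q \<Longrightarrow> qmult Q a (qone Q) = a"
    and qmult_Join_left:
      "\<lbrakk>A \<subseteq> carrier Q; b \<in> carrier Q\<rbrakk>
        \<Longrightarrow> qmult Q (Join Q A) b = Join Q ((\<lambda>a. qmult Q a b) ` A)"
    and qmult_Join_right:
      "\<lbrakk>a \<in> carrier Q; B \<subseteq> carrier Q\<rbrakk>
        \<Longrightarrow> qmult Q a (Join Q B) = Join Q (qmult Q a ` B)"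

locale quantale_hom = source: quantale Q + target: quantale R
  for Q :: "('a, 'm) quantale_scheme" and R :: "('b, 'n) quantale_scheme" +
  fixes h :: "'a \<Rightarrow> 'b"
  assumes hom_closed: "h \<in> carrier Q \<rightarrow> carrier R"
    and hom_Join: "A \<subseteq> carrier Q \<Longrightarrow> h (Join Q A) = Join R (h ` A)"
    and hom_qmult:
      "\<lbrakk>a \<in> carrier Q; b \<in> carrier Q\<rbrakk> \<Longrightarrow> h (qmult Q a b) = qmult R (h a) (h b)"
    and hom_qone: "h (qone Q) = qone R"

record ('q, 'a) quantale_module = "'a sup_lattice" +
  act :: "'q \<Rightarrow> 'a \<Rightarrow> 'a"

locale quantale_module = scalars: quantale Q + sup_lattice M
  for Q :: "('q, 'm) quantale_scheme" and M :: "('q, 'a, 'n) quantale_module_scheme" +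
  assumes act_closed:
      "\<lbrakk>q \<in> carrier Q; x \<in> carrier M\<rbrakk> \<Longrightarrow> act M q x \<in> carrier M"
    and act_assoc:
      "\<lbrakk>p \<in> carrier Q; q \<in> carrier Q; x \<in> carrier M\<rbrakk>
        \<Longrightarrow> act M (qmult Q p q) x = act M p (act M q x)"
    and act_one: "x \<in> carrier M \<Longrightarrow> act M (qone Q) x = x"
    and act_Join_left:
      "\<lbrakk>A \<subseteq> carrier Q; x \<in> carrier M\<rbrakk>
        \<Longrightarrow> act M (Join Q A) x = Join M ((\<lambda>q. act M q x) ` A)"
    and act_Join_right:
      "\<lbrakk>q \<in> carrier Q; X \<subseteq> carrier M\<rbrakk>
        \<Longrightarrow> act M q (Join M X) = Join M (act M q ` X)"

locale quantale_module_hom = source: quantale_module Q M + target: quantale_module Q N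
  for Q :: "('q, 'k) quantale_scheme"
    and M :: "('q, 'a, 'm) quantale_module_scheme"
    and N :: "('q, 'b, 'n) quantale_module_scheme" +
  fixes f :: "'a \<Rightarrow> 'b"
  assumes map_closed: "f \<in> carrier M \<rightarrow> carrier N"
    and map_Join: "X \<subseteq> carrier M \<Longrightarrow> f (Join M X) = Join N (f ` X)"
    and map_act:
      "\<lbrakk>q \<in> carrier Q; x \<in> carrier M\<rbrakk> \<Longrightarrow> f (act M q x) = act N q (f x)"

definition modules_isomorphic ::
    "('q, 'k) quantale_scheme \<Rightarrow> ('q, 'a, 'm) quantale_module_scheme
      \<Rightarrow> ('q, 'b, 'n) quantale_module_scheme \<Rightarrow> bool" where
  "modules_isomorphic Q M N \<longleftrightarrow>
    (\<exists>f. quantale_module_hom Q M N f \<and> bij_betw f (carrier M) (carrier N))"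

definition restrict_scalars ::
    "('q \<Rightarrow> 'r) \<Rightarrow> ('r, 'a) quantale_module \<Rightarrow> ('q, 'a) quantale_module" where
  "restrict_scalars h M =
    \<lparr>carrier = carrier M, eq = eq M, le = le M, Join = Join M,
      act = (\<lambda>q x. act M (h q) x)\<rparr>"

definition powerset_quantale :: "('a, 'm) monoid_scheme \<Rightarrow> 'a set quantale" where
  "powerset_quantale G =
    \<lparr>carrier = Pow (carrier G), eq = (=), le = (\<subseteq>), Join = Union,
      qmult = (\<lambda>A B. A <#>\<^bsub>G\<^esub> B), qone = {\<one>\<^bsub>G\<^esub>}\<rparr>"


section \<open>Languages, formulas, substitutions and sequents\<close>

text \<open>The fixed denumerable set of variables is the type \<^typ>\<open>nat\<close>.\<close>

type_synonym var = nat

record 'c language =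
  connectives :: "'c set"
  arity :: "'c \<Rightarrow> nat"

datatype 'c formula = Var var | Conn 'c "'c formula list"

text \<open>The datatype also contains terms that violate the arities; \<open>Fm L\<close> excludes them.\<close>

inductive_set Fm :: "'c language \<Rightarrow> 'c formula set" for L where
  Var: "Var x \<in> Fm L"
| Conn: "\<lbrakk>f \<in> connectives L; length \<phi>s = arity L f; \<And>\<phi>. \<phi> \<in> set \<phi>s \<Longrightarrow> \<phi> \<in> Fm L\<rbrakk>
    \<Longrightarrow> Conn f \<phi>s \<in> Fm L"

primrec vars :: "'c formula \<Rightarrow> var set" where
  "vars (Var x) = {x}"
| "vars (Conn f \<phi>s) = \<Union> (set (map vars \<phi>s))"

type_synonym 'c substitution = "var \<Rightarrow> 'c formula"

primrec subst :: "'c substitution \<Rightarrow> 'c formula \<Rightarrow> 'c formula" where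
  "subst \<sigma> (Var x) = \<sigma> x"
| "subst \<sigma> (Conn f \<phi>s) = Conn f (map (subst \<sigma>) \<phi>s)"

text \<open>
  A substitution is represented by its restriction to the variables, so the
  composite of \<open>\<sigma>\<^sub>1\<close> after \<open>\<sigma>\<^sub>2\<close> sends \<open>x\<close> to \<open>subst \<sigma>\<^sub>1 (\<sigma>\<^sub>2 x)\<close>.
\<close>

definition subst_monoid :: "'c language \<Rightarrow> 'c substitution monoid" where
  "subst_monoid L =
    \<lparr>carrier = {\<sigma>. \<forall>x. \<sigma> x \<in> Fm L}, mult = (\<lambda>\<sigma>\<^sub>1 \<sigma>\<^sub>2 x. subst \<sigma>\<^sub>1 (\<sigma>\<^sub>2 x)), one = Var\<rparr>"

definition subst_quantale :: "'c language \<Rightarrow> 'c substitution set quantale" where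
  "subst_quantale L = powerset_quantale (subst_monoid L)"

type_synonym 'c sequent = "'c formula list \<times> 'c formula list"

definition sequents :: "'c language \<Rightarrow> 'c sequent set" where
  "sequents L = {(\<Gamma>, \<Delta>). set \<Gamma> \<subseteq> Fm L \<and> set \<Delta> \<subseteq> Fm L \<and> \<not> (\<Gamma> = [] \<and> \<Delta> = [])}"

definition seq_type :: "'c sequent \<Rightarrow> nat \<times> nat" where
  "seq_type s = (length (fst s), length (snd s))"

definition closed_under_type :: "'c language \<Rightarrow> 'c sequent set \<Rightarrow> bool" where
  "closed_under_type L S \<longleftrightarrow>
    (\<forall>s\<in>S. \<forall>t\<in>sequents L. seq_type t = seq_type s \<longrightarrow> t \<in> S)"

definition subst_sequent :: "'c substitution \<Rightarrow> 'c sequent \<Rightarrow> 'c sequent" where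
  "subst_sequent \<sigma> = map_prod (map (subst \<sigma>)) (map (subst \<sigma>))"

definition subst_act :: "'c substitution set \<Rightarrow> 'c sequent set \<Rightarrow> 'c sequent set" where
  "subst_act \<Sigma> \<Phi> = {subst_sequent \<sigma> \<phi> | \<sigma> \<phi>. \<sigma> \<in> \<Sigma> \<and> \<phi> \<in> \<Phi>}"


section \<open>Deductive systems\<close>

text \<open>
  The values of \<open>entails\<close> on sets that are not contained in \<open>domain\<close> are irrelevant.
\<close>

record 'c system =
  lang :: "'c language"
  domain :: "'c sequent set"
  entails :: "'c sequent set \<Rightarrow> 'c sequent set \<Rightarrow> bool"

locale deductive_system =
  fixes \<S> :: "'c system"
  assumes domain_sequents: "domain \<S> \<subseteq> sequents (lang \<S>)"
    and domain_closed: "closed_under_type (lang \<S>) (domain \<S>)"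
    and entails_superset:
      "\<lbrakk>\<Phi> \<subseteq> domain \<S>; \<Psi> \<subseteq> \<Phi>\<rbrakk> \<Longrightarrow> entails \<S> \<Phi> \<Psi>"
    and entails_trans:
      "\<lbrakk>\<Phi> \<subseteq> domain \<S>; \<Psi> \<subseteq> domain \<S>; \<Xi> \<subseteq> domain \<S>; entails \<S> \<Phi> \<Psi>; entails \<S> \<Psi> \<Xi>\<rbrakk>
        \<Longrightarrow> entails \<S> \<Phi> \<Xi>"
    and entails_Union:
      "\<Phi> \<subseteq> domain \<S> \<Longrightarrow> entails \<S> \<Phi> (\<Union>{\<Psi>. \<Psi> \<subseteq> domain \<S> \<and> entails \<S> \<Phi> \<Psi>})"
    and entails_finitary:
      "\<lbrakk>\<Phi> \<subseteq> domain \<S>; \<Psi> \<subseteq> domain \<S>; finite \<Psi>; entails \<S> \<Phi> \<Psi>\<rbrakk>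
        \<Longrightarrow> \<exists>\<Phi>\<^sub>0. finite \<Phi>\<^sub>0 \<and> \<Phi>\<^sub>0 \<subseteq> \<Phi> \<and> entails \<S> \<Phi>\<^sub>0 \<Psi>"
    and entails_subst:
      "\<lbrakk>\<Phi> \<subseteq> domain \<S>; \<Psi> \<subseteq> domain \<S>; \<sigma> \<in> carrier (subst_monoid (lang \<S>)); entails \<S> \<Phi> \<Psi>\<rbrakk>
        \<Longrightarrow> entails \<S> (subst_sequent \<sigma> ` \<Phi>) (subst_sequent \<sigma> ` \<Psi>)"

definition closure_of_system :: "'c system \<Rightarrow> 'c sequent set \<Rightarrow> 'c sequent set" where
  "closure_of_system \<S> \<Phi> = \<Union>{\<Psi>. \<Psi> \<subseteq> domain \<S> \<and> entails \<S> \<Phi> \<Psi>}"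

definition theory_module ::
    "'c system \<Rightarrow> ('c substitution set, 'c sequent set) quantale_module" where
  "theory_module \<S> =
    \<lparr>carrier = closure_of_system \<S> ` Pow (domain \<S>), eq = (=), le = (\<subseteq>),
      Join = (\<lambda>\<A>. closure_of_system \<S> (\<Union>\<A>)),
      act = (\<lambda>\<Sigma> \<Phi>. closure_of_system \<S> (subst_act \<Sigma> \<Phi>))\<rparr>"


section \<open>Language translations and faithful interpretations\<close>

definition derived_connective ::
    "'c language \<Rightarrow> nat \<Rightarrow> ('c formula list \<Rightarrow> 'c formula) \<Rightarrow> bool" where
  "derived_connective L n g \<longleftrightarrow>
    (\<exists>\<phi>\<in>Fm L. \<exists>xs. distinct xs \<and> length xs = n \<and> vars \<phi> \<subseteq> set xs \<and>
      (\<forall>\<psi>s. length \<psi>s = n \<and> set \<psi>s \<subseteq> Fm L \<longrightarrow>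
        g \<psi>s = subst (\<lambda>y. case map_of (zip xs \<psi>s) y of None \<Rightarrow> Var y | Some \<psi> \<Rightarrow> \<psi>) \<phi>))"

definition language_translation ::
    "'c language \<Rightarrow> 'd language \<Rightarrow> ('c formula \<Rightarrow> 'd formula) \<Rightarrow> bool" where
  "language_translation L L' \<tau> \<longleftrightarrow>
    \<tau> \<in> Fm L \<rightarrow> Fm L' \<and>
    (\<forall>x. {\<phi> \<in> Fm L. \<tau> \<phi> = Var x} = {Var x}) \<and>
    (\<exists>d. \<forall>f\<in>connectives L. derived_connective L' (arity L f) (d f) \<and>
      (\<forall>\<phi>s. length \<phi>s = arity L f \<and> set \<phi>s \<subseteq> Fm L \<longrightarrow>
        \<tau> (Conn f \<phi>s) = d f (map \<tau> \<phi>s)))"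

definition translate_substs ::
    "('c formula \<Rightarrow> 'd formula) \<Rightarrow> 'c substitution set \<Rightarrow> 'd substitution set" where
  "translate_substs \<tau> \<Sigma> = (\<lambda>\<sigma>. \<tau> \<circ> \<sigma>) ` \<Sigma>"

definition faithful_interpretation ::
    "'c system \<Rightarrow> 'd system \<Rightarrow> ('c sequent set \<Rightarrow> 'd sequent set) \<Rightarrow> bool" where
  "faithful_interpretation \<S> \<T> \<iota> \<longleftrightarrow>
    \<iota> \<in> Pow (domain \<S>) \<rightarrow> Pow (domain \<T>) \<and>
    (\<forall>\<A> \<subseteq> Pow (domain \<S>). \<iota> (\<Union>\<A>) = \<Union>(\<iota> ` \<A>)) \<and>
    (\<exists>\<tau>. language_translation (lang \<S>) (lang \<T>) \<tau> \<and>
      (\<forall>\<Phi> \<subseteq> domain \<S>. \<forall>\<Psi> \<subseteq> domain \<S>. entails \<S> \<Phi> \<Psi> \<longleftrightarrow> entails \<T> (\<iota> \<Phi>) (\<iota> \<Psi>)) \<and>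
      (\<forall>\<Phi> \<subseteq> domain \<S>. \<forall>\<Sigma> \<subseteq> carrier (subst_monoid (lang \<S>)).
        \<iota> (subst_act \<Sigma> \<Phi>) = subst_act (translate_substs \<tau> \<Sigma>) (\<iota> \<Phi>)))"

definition equivalent_systems :: "'c system \<Rightarrow> 'd system \<Rightarrow> bool" where
  "equivalent_systems \<S> \<T> \<longleftrightarrow>
    (\<exists>\<iota> \<iota>'. faithful_interpretation \<S> \<T> \<iota> \<and> faithful_interpretation \<T> \<S> \<iota>' \<and>
      (\<forall>\<Phi> \<subseteq> domain \<S>. entails \<S> \<Phi> (\<iota>' (\<iota> \<Phi>)) \<and> entails \<S> (\<iota>' (\<iota> \<Phi>)) \<Phi>))"

end

theory Submission
  imports Defs
begin

text \<open>
  A faithful interpretation \<open>\<iota>\<close> preserves and reflects entailment, so \<open>\<Phi> \<mapsto> \<delta> (\<iota> \<Phi>)\<close> is an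
  injective module homomorphism on theories. It is also surjective, because \<open>\<iota>' (\<iota> (\<iota>' \<Psi>))\<close> and
  \<open>\<iota>' \<Psi>\<close> are interderivable and \<open>\<iota>'\<close> reflects entailment: hence \<open>\<iota> (\<iota>' \<Psi>)\<close> and \<open>\<Psi>\<close> are
  interderivable as well. Its inverse is the homomorphism induced by \<open>\<iota>'\<close>, which is linear over
  the substitutions of the second language; so the same bijection serves for both languages.
\<close>

section \<open>Quantales and modules\<close>

text \<open>Meets come from joins: the infimum of a family is the join of all its lower bounds. The
  join is left abstract so that the lemma covers both plain unions and closures of unions.\<close>

lemma sup_lattice_of_sets:
  fixes L :: "('a set, 'm) sup_lattice_scheme"
  assumes eq: "eq L = (=)" and le: "le L = (\<subseteq>)"
    and closed: "\<And>\<A>. \<A> \<subseteq> carrier L \<Longrightarrow> Join L \<A> \<in> carrier L"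
    and upper: "\<And>\<A> A. \<lbrakk>\<A> \<subseteq> carrier L; A \<in> \<A>\<rbrakk> \<Longrightarrow> A \<subseteq> Join L \<A>"
    and least: "\<And>\<A> B. \<lbrakk>\<A> \<subseteq> carrier L; B \<in> carrier L; \<And>A. A \<in> \<A> \<Longrightarrow> A \<subseteq> B\<rbrakk> \<Longrightarrow> Join L \<A> \<subseteq> B"
  shows "sup_lattice L"
proof -
  have po: "partial_order L"
    by unfold_locales (auto simp: eq le)
  have lub: "is_lub L (Join L \<A>) \<A>" if "\<A> \<subseteq> carrier L" for \<A>
  proof -
    have "Join L \<A> \<subseteq> B" if "B \<in> Upper L \<A>" for B
      using that \<open>\<A> \<subseteq> carrier L\<close> by (intro least) (auto simp: Upper_def le)
    moreover have "Join L \<A> \<in> Upper L \<A>"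
      using closed[OF that] upper[OF that] by (simp add: Upper_def le)
    ultimately show ?thesis
      by (simp add: least_def le)
  qed
  have glb: "greatest L (Join L (Lower L \<A>)) (Lower L \<A>)" if \<A>: "\<A> \<subseteq> carrier L" for \<A>
  proof -
    have lower: "Lower L \<A> \<subseteq> carrier L"
      by (auto simp: Lower_def)
    have "Join L (Lower L \<A>) \<subseteq> A" if "A \<in> \<A>" for A
      using that \<A> by (intro least lower) (auto simp: Lower_def le)
    then have "Join L (Lower L \<A>) \<in> Lower L \<A>"
      using closed[OF lower] by (auto simp: Lower_def le)
    then show ?thesis
      using upper[OF lower] lower by (auto simp: greatest_def le)
  qed
  have "complete_lattice L"
    using partial_order.complete_latticeI[OF po] lub glb by blast
  then show ?thesis
    using lub by (intro sup_lattice.intro sup_lattice_axioms.intro)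
qed

lemma quantale_powerset:
  assumes "monoid G"
  shows "quantale (powerset_quantale G)"
proof -
  interpret monoid G by fact
  have "sup_lattice (powerset_quantale G)"
    by (rule sup_lattice_of_sets) (simp_all add: powerset_quantale_def, blast+)
  moreover have "quantale_axioms (powerset_quantale G)"
  proof (unfold_locales, goal_cases)
    \<comment> \<open>Associativity is the only law that needs the three sets to lie in the carrier
      in unfolded form, since \<open>m_assoc\<close> is conditional on membership.\<close>
    case (3 A B C)
    then have "A \<subseteq> carrier G" "B \<subseteq> carrier G" "C \<subseteq> carrier G"
      by (auto simp: powerset_quantale_def)
    then show ?case
      by (simp add: powerset_quantale_def set_mult_def)
        (intro SUP_cong refl; simp add: m_assoc subset_iff)
  qed (auto simp: powerset_quantale_def set_mult_def; force)+
  ultimately show ?thesis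
    by (rule quantale.intro)
qed

section \<open>Restriction of scalars and inverses of homomorphisms\<close>

lemma restrict_scalars_simps:
  "carrier (restrict_scalars h M) = carrier M" "eq (restrict_scalars h M) = eq M"
  "le (restrict_scalars h M) = le M" "Join (restrict_scalars h M) = Join M"
  "act (restrict_scalars h M) q x = act M (h q) x"
  by (simp_all add: restrict_scalars_def)

text \<open>The order and the joins are those of \<open>M\<close>, so the lattice laws carry over;
  the laws of the action hold because \<open>h\<close> preserves products, the unit and
  joins.\<close>

lemma quantale_module_restrict_scalars:
  assumes "quantale_hom Q R h" and "quantale_module R M"
  shows "quantale_module Q (restrict_scalars h M)"
proof -
  interpret h: quantale_hom Q R h by fact
  interpret M: quantale_module R M by fact
  have po: "partial_order (restrict_scalars h M)"
    by unfold_locales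
      (simp_all add: restrict_scalars_simps M.eq_is_equal,
        (blast intro: M.le_antisym M.le_trans)+)
  \<comment> \<open>The new record is a different structure, but bounds depend only on the carrier
    and the order, which it shares with \<open>M\<close>.\<close>
  have lub: "is_lub (restrict_scalars h M) x A \<longleftrightarrow> is_lub M x A" for x A
    by (simp add: restrict_scalars_simps least_def Upper_def)
  have glb: "greatest (restrict_scalars h M) x (Lower (restrict_scalars h M) A)
      \<longleftrightarrow> greatest M x (Lower M A)" for x A
    by (simp add: restrict_scalars_simps greatest_def Lower_def)
  have "complete_lattice (restrict_scalars h M)"
    by (rule partial_order.complete_latticeI[OF po])
      (simp_all add: lub glb M.sup_exists M.inf_exists restrict_scalars_simps)
  then have "sup_lattice (restrict_scalars h M)"
    by (intro sup_lattice.intro sup_lattice_axioms.intro)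
      (simp_all add: lub M.Join_lub restrict_scalars_simps)
  moreover have "quantale_module_axioms Q (restrict_scalars h M)"
  proof (unfold_locales, goal_cases)
    case (4 A x)
    then have "h ` A \<subseteq> carrier R"
      using h.hom_closed by auto
    with 4 show ?case
      by (simp add: restrict_scalars_simps h.hom_Join M.act_Join_left image_image)
  qed (use h.hom_closed in \<open>auto simp: restrict_scalars_simps h.hom_qmult h.hom_qone
        M.act_closed M.act_assoc M.act_one M.act_Join_right Pi_iff\<close>)
  ultimately show ?thesis
    using h.source.quantale_axioms by (intro quantale_module.intro)
qed

text \<open>Each law for \<open>g\<close> follows by applying \<open>f\<close> to the expression in
  \<open>M\<close>, using the law for \<open>f\<close>, and cancelling with \<open>gf\<close>. It
  serves to turn a homomorphism induced by one interpretation into one that runs in the opposite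
  direction.\<close>

lemma quantale_module_hom_inverse:
  assumes "quantale_module_hom Q M N f" and g: "g \<in> carrier N \<rightarrow> carrier M"
    and gf: "\<And>x. x \<in> carrier M \<Longrightarrow> g (f x) = x" and fg: "\<And>y. y \<in> carrier N \<Longrightarrow> f (g y) = y"
  shows "quantale_module_hom Q N M g"
proof -
  interpret f: quantale_module_hom Q M N f by fact
  show ?thesis
  proof (unfold_locales, goal_cases)
    case 1
    show ?case by (rule g)
  next
    case (2 Y)
    then have gY: "g ` Y \<subseteq> carrier M"
      using g by auto
    have "f ` g ` Y = Y"
      using 2 fg by (simp add: image_image subset_iff)
    then have "f (Join M (g ` Y)) = Join N Y"
      by (simp add: f.map_Join[OF gY])
    \<comment> \<open>Membership in the carrier is what allows \<open>gf\<close> to cancel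
      \<open>f\<close> in the preceding equation.\<close>
    moreover have "Join M (g ` Y) \<in> carrier M"
      using f.source.Join_lub[OF gY] by (auto simp: least_def Upper_def)
    ultimately show ?case
      using gf by metis
  next
    case (3 q y)
    then have gy: "g y \<in> carrier M"
      using g by auto
    have "f (act M q (g y)) = act N q y"
      using 3 gy by (simp add: f.map_act fg)
    then show ?case
      using gf f.source.act_closed[OF 3(1) gy] by metis
  qed
qed


section \<open>Substitutions and translations\<close>

lemma subst_in_Fm:
  assumes "\<phi> \<in> Fm L" and "\<And>x. \<sigma> x \<in> Fm L"
  shows "subst \<sigma> \<phi> \<in> Fm L"
  using assms by induction (auto intro!: Fm.intros)

lemma subst_subst: "subst \<sigma> (subst \<rho> \<phi>) = subst (\<lambda>x. subst \<sigma> (\<rho> x)) \<phi>"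
  by (induction \<phi>) auto

lemma subst_Var [simp]: "subst Var \<phi> = \<phi>"
  by (induction \<phi>) (auto simp: map_idI)

lemma subst_cong: "(\<And>x. x \<in> vars \<phi> \<Longrightarrow> \<sigma> x = \<rho> x) \<Longrightarrow> subst \<sigma> \<phi> = subst \<rho> \<phi>"
  by (induction \<phi>) auto

lemma carrier_subst_monoid: "\<sigma> \<in> carrier (subst_monoid L) \<longleftrightarrow> (\<forall>x. \<sigma> x \<in> Fm L)"
  by (simp add: subst_monoid_def)

lemma monoid_subst_monoid: "monoid (subst_monoid L)"
  by unfold_locales (auto simp: subst_monoid_def subst_subst intro: Fm.Var subst_in_Fm)

lemma quantale_subst_quantale: "quantale (subst_quantale L)"
  unfolding subst_quantale_def by (intro quantale_powerset monoid_subst_monoid)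

text \<open>All variables of the defining formula are among the parameters \<open>xs\<close>, so
  after instantiation \<open>\<sigma>\<close> meets only the arguments.\<close>

lemma derived_connective_subst:
  assumes "derived_connective L n g" and "length \<psi>s = n" and "set \<psi>s \<subseteq> Fm L"
    and \<sigma>: "\<And>x. \<sigma> x \<in> Fm L"
  shows "subst \<sigma> (g \<psi>s) = g (map (subst \<sigma>) \<psi>s)"
proof -
  let ?inst = "\<lambda>xs \<psi>s y. case map_of (zip xs \<psi>s) y of None \<Rightarrow> Var y | Some \<psi> \<Rightarrow> \<psi>"
  obtain \<phi> xs where xs: "length xs = n" "vars \<phi> \<subseteq> set xs"
    and g: "\<And>\<psi>s. length \<psi>s = n \<Longrightarrow> set \<psi>s \<subseteq> Fm L \<Longrightarrow> g \<psi>s = subst (?inst xs \<psi>s) \<phi>"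
    using assms(1) unfolding derived_connective_def by blast
  have "subst \<sigma> (?inst xs \<psi>s y) = ?inst xs (map (subst \<sigma>) \<psi>s) y" if "y \<in> vars \<phi>" for y
  proof -
    \<comment> \<open>This excludes the default \<open>Var y\<close>, which \<open>\<sigma>\<close>
      would change on the left-hand side only.\<close>
    have "y \<in> set xs"
      using that xs by auto
    then obtain \<psi> where \<psi>: "map_of (zip xs \<psi>s) y = Some \<psi>"
      using map_of_zip_is_Some[of xs \<psi>s y] xs assms(2) by auto
    then have "map_of (zip xs (map (subst \<sigma>) \<psi>s)) y = Some (subst \<sigma> \<psi>)"
      by (simp add: zip_map2 map_of_map)
    then show ?thesis
      using \<psi> by simp
  qed
  then have "subst \<sigma> (subst (?inst xs \<psi>s) \<phi>) = subst (?inst xs (map (subst \<sigma>) \<psi>s)) \<phi>"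
    unfolding subst_subst by (rule subst_cong)
  moreover have "set (map (subst \<sigma>) \<psi>s) \<subseteq> Fm L"
    using assms(3) \<sigma> by (auto intro!: subst_in_Fm)
  ultimately show ?thesis
    using assms(2,3) by (simp add: g)
qed

lemma language_translation_in_Fm:
  "\<lbrakk>language_translation L L' \<tau>; \<phi> \<in> Fm L\<rbrakk> \<Longrightarrow> \<tau> \<phi> \<in> Fm L'"
  by (auto simp: language_translation_def)

lemma language_translation_Var: "language_translation L L' \<tau> \<Longrightarrow> \<tau> (Var x) = Var x"
  unfolding language_translation_def by blast

text \<open>Variables are fixed by \<open>\<tau>\<close>, and a compound formula becomes a derived
  connective applied to translated arguments, which commutes with substitution. This is what makes
  \<open>\<sigma> \<mapsto> \<tau> \<circ> \<sigma>\<close> multiplicative.\<close>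

lemma language_translation_subst:
  assumes \<tau>: "language_translation L L' \<tau>" and "\<phi> \<in> Fm L" and \<sigma>: "\<And>x. \<sigma> x \<in> Fm L"
  shows "\<tau> (subst \<sigma> \<phi>) = subst (\<tau> \<circ> \<sigma>) (\<tau> \<phi>)"
  using assms(2)
proof induction
  case (Var x)
  then show ?case
    by (simp add: language_translation_Var[OF \<tau>])
next
  case (Conn f \<phi>s)
  obtain d where d: "derived_connective L' (arity L f) (d f)"
    and \<tau>d: "\<And>\<phi>s. length \<phi>s = arity L f \<Longrightarrow> set \<phi>s \<subseteq> Fm L \<Longrightarrow> \<tau> (Conn f \<phi>s) = d f (map \<tau> \<phi>s)"
    using \<tau> Conn.hyps(1) unfolding language_translation_def by blast
  have sub: "set \<phi>s \<subseteq> Fm L"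
    using Conn.hyps by blast
  have "\<tau> (subst \<sigma> (Conn f \<phi>s)) = d f (map \<tau> (map (subst \<sigma>) \<phi>s))"
    using sub \<sigma> Conn.hyps(2) by (simp del: map_map) (rule \<tau>d; auto intro: subst_in_Fm)
  also have "map \<tau> (map (subst \<sigma>) \<phi>s) = map (subst (\<tau> \<circ> \<sigma>)) (map \<tau> \<phi>s)"
    using Conn.IH by (simp add: o_def)
  also have "d f \<dots> = subst (\<tau> \<circ> \<sigma>) (d f (map \<tau> \<phi>s))"
    using d Conn.hyps(2) sub \<sigma>
    by (intro derived_connective_subst[symmetric]) (auto intro: language_translation_in_Fm[OF \<tau>])
  also have "d f (map \<tau> \<phi>s) = \<tau> (Conn f \<phi>s)"
    using \<tau>d Conn.hyps(2) sub by simp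
  finally show ?case .
qed

text \<open>Composition with \<open>\<tau>\<close> is a homomorphism between the monoids of
  substitutions, and taking images under a monoid homomorphism preserves unions, complex products
  and the unit.\<close>

lemma quantale_hom_translate_substs:
  assumes \<tau>: "language_translation L L' \<tau>"
  shows "quantale_hom (subst_quantale L) (subst_quantale L') (translate_substs \<tau>)"
proof -
  have mult: "translate_substs \<tau> (A <#>\<^bsub>subst_monoid L\<^esub> B)
      = translate_substs \<tau> A <#>\<^bsub>subst_monoid L'\<^esub> translate_substs \<tau> B"
    if "A \<subseteq> carrier (subst_monoid L)" "B \<subseteq> carrier (subst_monoid L)" for A B
  proof -
    \<comment> \<open>At a variable \<open>x\<close> this is the commutation of
      \<open>\<tau>\<close> with substitution, applied to the formula
      \<open>\<rho> x\<close>.\<close>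
    have "\<tau> \<circ> (\<sigma> \<otimes>\<^bsub>subst_monoid L\<^esub> \<rho>) = (\<tau> \<circ> \<sigma>) \<otimes>\<^bsub>subst_monoid L'\<^esub> (\<tau> \<circ> \<rho>)"
      if "\<sigma> \<in> carrier (subst_monoid L)" "\<rho> \<in> carrier (subst_monoid L)" for \<sigma> \<rho>
      using that language_translation_subst[OF \<tau>]
      by (simp add: subst_monoid_def fun_eq_iff)
    then show ?thesis
      using that by (simp add: translate_substs_def set_mult_def image_UN subset_iff)
  qed
  have "quantale_hom_axioms (subst_quantale L) (subst_quantale L') (translate_substs \<tau>)"
  proof (unfold_locales, goal_cases)
    case 1
    then show ?case
      using language_translation_in_Fm[OF \<tau>]
      by (fastforce simp: subst_quantale_def powerset_quantale_def translate_substs_def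
          carrier_subst_monoid)
  next
    case (2 A)
    then show ?case
      by (auto simp: subst_quantale_def powerset_quantale_def translate_substs_def)
  next
    case (3 A B)
    then show ?case
      using mult by (simp add: subst_quantale_def powerset_quantale_def)
  next
    case 4
    have "\<tau> \<circ> Var = Var"
      by (simp add: fun_eq_iff language_translation_Var[OF \<tau>])
    then show ?case
      by (simp add: subst_quantale_def powerset_quantale_def translate_substs_def subst_monoid_def)
  qed
  then show ?thesis
    by (intro quantale_hom.intro quantale_subst_quantale)
qed

section \<open>The action of sets of substitutions on sets of sequents\<close>

lemma subst_sequent_Var [simp]: "subst_sequent Var s = s"
  by (cases s) (simp add: subst_sequent_def map_idI)

lemma subst_sequent_mult:
  "subst_sequent (\<sigma> \<otimes>\<^bsub>subst_monoid L\<^esub> \<rho>) s = subst_sequent \<sigma> (subst_sequent \<rho> s)"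
  by (cases s) (simp add: subst_sequent_def subst_monoid_def subst_subst)

lemma subst_act_mono: "\<Phi> \<subseteq> \<Psi> \<Longrightarrow> subst_act \<Sigma> \<Phi> \<subseteq> subst_act \<Sigma> \<Psi>"
  by (auto simp: subst_act_def)

lemma subst_act_one: "subst_act {\<one>\<^bsub>subst_monoid L\<^esub>} \<Phi> = \<Phi>"
  by (auto simp: subst_act_def subst_monoid_def)

lemma subst_act_mult:
  "subst_act (\<Sigma> <#>\<^bsub>subst_monoid L\<^esub> \<Sigma>') \<Phi> = subst_act \<Sigma> (subst_act \<Sigma>' \<Phi>)"
proof -
  \<comment> \<open>Written as nested unions, the action and the complex product flatten in the same
    way, leaving only the law for single sequents.\<close>
  have UN: "subst_act \<Sigma> \<Phi> = (\<Union>\<sigma>\<in>\<Sigma>. \<Union>\<phi>\<in>\<Phi>. {subst_sequent \<sigma> \<phi>})" for \<Sigma> \<Phi>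
    by (auto simp: subst_act_def)
  show ?thesis
    by (simp add: UN set_mult_def subst_sequent_mult)
qed

lemma subst_act_Union_left: "subst_act (\<Union>\<A>) \<Phi> = (\<Union>\<Sigma>\<in>\<A>. subst_act \<Sigma> \<Phi>)"
  by (auto simp: subst_act_def)

lemma subst_act_Union_right: "subst_act \<Sigma> (\<Union>\<A>) = (\<Union>\<Phi>\<in>\<A>. subst_act \<Sigma> \<Phi>)"
  by (auto simp: subst_act_def)


section \<open>The module of theories\<close>

context deductive_system
begin

section \<open>The closure operator of a deductive system\<close>

abbreviation cl where "cl \<equiv> closure_of_system \<S>"

lemma cl_in_domain: "cl \<Phi> \<subseteq> domain \<S>"
  by (auto simp: closure_of_system_def)

text \<open>By \<open>entails_Union\<close> a set entails its whole closure, hence by transitivity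
  every part of it. From here on entailment is handled as inclusion in a closure.\<close>

lemma entails_iff:
  assumes "\<Phi> \<subseteq> domain \<S>" and "\<Psi> \<subseteq> domain \<S>"
  shows "entails \<S> \<Phi> \<Psi> \<longleftrightarrow> \<Psi> \<subseteq> cl \<Phi>"
proof
  assume "\<Psi> \<subseteq> cl \<Phi>"
  then have "entails \<S> (cl \<Phi>) \<Psi>"
    using cl_in_domain by (intro entails_superset)
  moreover have "entails \<S> \<Phi> (cl \<Phi>)"
    using assms entails_Union by (simp add: closure_of_system_def)
  ultimately show "entails \<S> \<Phi> \<Psi>"
    using assms cl_in_domain entails_trans[of \<Phi> "cl \<Phi>" \<Psi>] by simp
qed (use assms in \<open>auto simp: closure_of_system_def\<close>)

lemma cl_extensive: "\<Phi> \<subseteq> domain \<S> \<Longrightarrow> \<Phi> \<subseteq> cl \<Phi>"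
  by (rule iffD1[OF entails_iff]) (simp_all add: entails_superset)

text \<open>Transitivity in closure form: \<open>\<Psi>\<close> entails \<open>\<Phi>\<close>, which
  entails \<open>cl \<Phi>\<close>.\<close>

lemma cl_least:
  assumes \<Psi>: "\<Psi> \<subseteq> domain \<S>" and sub: "\<Phi> \<subseteq> cl \<Psi>"
  shows "cl \<Phi> \<subseteq> cl \<Psi>"
proof -
  have \<Phi>: "\<Phi> \<subseteq> domain \<S>"
    using sub cl_in_domain by (rule order_trans)
  have "entails \<S> \<Psi> \<Phi>" "entails \<S> \<Phi> (cl \<Phi>)"
    using \<Phi> \<Psi> sub by (simp_all add: entails_iff cl_in_domain)
  then have "entails \<S> \<Psi> (cl \<Phi>)"
    by (rule entails_trans[OF \<Psi> \<Phi> cl_in_domain])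
  then show ?thesis
    using \<Psi> by (simp add: entails_iff cl_in_domain)
qed

lemma cl_mono: "\<lbrakk>\<Psi> \<subseteq> domain \<S>; \<Phi> \<subseteq> \<Psi>\<rbrakk> \<Longrightarrow> cl \<Phi> \<subseteq> cl \<Psi>"
  by (rule cl_least, assumption, erule order_trans, rule cl_extensive)

lemma cl_idem [simp]: "\<Phi> \<subseteq> domain \<S> \<Longrightarrow> cl (cl \<Phi>) = cl \<Phi>"
  by (intro subset_antisym cl_extensive cl_in_domain) (simp_all add: cl_least)

lemma cl_eq_iff:
  assumes "\<Phi> \<subseteq> domain \<S>" and "\<Psi> \<subseteq> domain \<S>"
  shows "cl \<Phi> = cl \<Psi> \<longleftrightarrow> entails \<S> \<Phi> \<Psi> \<and> entails \<S> \<Psi> \<Phi>"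
  unfolding entails_iff[OF assms] entails_iff[OF assms(2,1)]
  using cl_least[OF assms(1), of \<Psi>] cl_least[OF assms(2), of \<Phi>]
    cl_extensive[OF assms(1)] cl_extensive[OF assms(2)] by blast

text \<open>Allows joins of theories to be computed on generating sets.\<close>

lemma cl_UN_cl:
  assumes "\<And>i. i \<in> I \<Longrightarrow> \<Phi> i \<subseteq> domain \<S>"
  shows "cl (\<Union>i\<in>I. cl (\<Phi> i)) = cl (\<Union>i\<in>I. \<Phi> i)"
proof
  have U: "(\<Union>i\<in>I. \<Phi> i) \<subseteq> domain \<S>"
    using assms by auto
  then show "cl (\<Union>i\<in>I. cl (\<Phi> i)) \<subseteq> cl (\<Union>i\<in>I. \<Phi> i)"
    by (intro cl_least UN_least cl_mono) auto
  show "cl (\<Union>i\<in>I. \<Phi> i) \<subseteq> cl (\<Union>i\<in>I. cl (\<Phi> i))"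
    by (intro cl_mono UN_mono) (auto simp: cl_extensive assms dest: subsetD[OF cl_in_domain])
qed

text \<open>Substitution keeps the lengths of both sides, and the domain is closed under
  type.\<close>

lemma subst_sequent_in_domain:
  assumes s: "s \<in> domain \<S>" and \<sigma>: "\<sigma> \<in> carrier (subst_monoid (lang \<S>))"
  shows "subst_sequent \<sigma> s \<in> domain \<S>"
proof -
  have "s \<in> sequents (lang \<S>)"
    using s domain_sequents by auto
  then have "subst_sequent \<sigma> s \<in> sequents (lang \<S>)"
    using \<sigma> by (auto simp: sequents_def subst_sequent_def carrier_subst_monoid subset_iff
        intro!: subst_in_Fm)
  moreover have "seq_type (subst_sequent \<sigma> s) = seq_type s"
    by (simp add: seq_type_def subst_sequent_def)
  ultimately show ?thesis
    using s domain_closed unfolding closed_under_type_def by blast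
qed

lemma subst_act_in_domain:
  "\<lbrakk>\<Sigma> \<subseteq> carrier (subst_monoid (lang \<S>)); \<Phi> \<subseteq> domain \<S>\<rbrakk> \<Longrightarrow> subst_act \<Sigma> \<Phi> \<subseteq> domain \<S>"
  unfolding subst_act_def using subst_sequent_in_domain by blast

text \<open>Substitution invariance, applied to the entailment of \<open>cl \<Phi>\<close> by
  \<open>\<Phi>\<close> for one \<open>\<sigma>\<close> at a time. Thus the action on theories can
  be computed on generators, which gives its associativity and its compatibility with joins.\<close>

lemma cl_subst_act_cl:
  assumes \<Sigma>: "\<Sigma> \<subseteq> carrier (subst_monoid (lang \<S>))" and \<Phi>: "\<Phi> \<subseteq> domain \<S>"
  shows "cl (subst_act \<Sigma> (cl \<Phi>)) = cl (subst_act \<Sigma> \<Phi>)"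
proof
  note dom = subst_act_in_domain[OF \<Sigma>]
  have "subst_sequent \<sigma> ` cl \<Phi> \<subseteq> cl (subst_act \<Sigma> \<Phi>)" if "\<sigma> \<in> \<Sigma>" for \<sigma>
  proof -
    have \<sigma>: "\<sigma> \<in> carrier (subst_monoid (lang \<S>))"
      using that \<Sigma> by auto
    have "entails \<S> \<Phi> (cl \<Phi>)"
      using \<Phi> cl_in_domain by (simp add: entails_iff)
    then have "entails \<S> (subst_sequent \<sigma> ` \<Phi>) (subst_sequent \<sigma> ` cl \<Phi>)"
      using \<Phi> \<sigma> cl_in_domain by (intro entails_subst)
    then have "subst_sequent \<sigma> ` cl \<Phi> \<subseteq> cl (subst_sequent \<sigma> ` \<Phi>)"
      using \<Phi> \<sigma> cl_in_domain subst_sequent_in_domain by (subst (asm) entails_iff) blast+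
    also have "\<dots> \<subseteq> cl (subst_act \<Sigma> \<Phi>)"
      using that by (intro cl_mono dom \<Phi>) (auto simp: subst_act_def)
    finally show ?thesis .
  qed
  then show "cl (subst_act \<Sigma> (cl \<Phi>)) \<subseteq> cl (subst_act \<Sigma> \<Phi>)"
    by (intro cl_least dom \<Phi>) (auto simp: subst_act_def)
  show "cl (subst_act \<Sigma> \<Phi>) \<subseteq> cl (subst_act \<Sigma> (cl \<Phi>))"
    using \<Phi> by (intro cl_mono dom cl_in_domain subst_act_mono cl_extensive)
qed

section \<open>Theories as fixed points, and their module structure\<close>

lemma theory_iff: "\<Phi> \<in> carrier (theory_module \<S>) \<longleftrightarrow> \<Phi> \<subseteq> domain \<S> \<and> cl \<Phi> = \<Phi>"
  using cl_in_domain by (auto simp: theory_module_def)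

lemma cl_in_theories: "\<Phi> \<subseteq> domain \<S> \<Longrightarrow> cl \<Phi> \<in> carrier (theory_module \<S>)"
  using cl_in_domain by (simp add: theory_iff)

lemma theory_module_simps:
  "eq (theory_module \<S>) = (=)" "le (theory_module \<S>) = (\<subseteq>)"
  "Join (theory_module \<S>) \<A> = cl (\<Union>\<A>)" "act (theory_module \<S>) \<Sigma> \<Phi> = cl (subst_act \<Sigma> \<Phi>)"
  by (simp_all add: theory_module_def)

text \<open>Every law is the corresponding law for sets of sequents under an outer closure; the
  inner closures are removed by \<open>cl_subst_act_cl\<close> and \<open>cl_UN_cl\<close>.\<close>

lemma quantale_module_theory_module:
  "quantale_module (subst_quantale (lang \<S>)) (theory_module \<S>)"
proof -
  have dom: "\<Union>\<A> \<subseteq> domain \<S>" if "\<A> \<subseteq> carrier (theory_module \<S>)" for \<A>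
    using that theory_iff by blast
  have lattice: "sup_lattice (theory_module \<S>)"
  proof (rule sup_lattice_of_sets, goal_cases)
    \<comment> \<open>The upper bound \<open>B\<close> is itself a theory, so
      \<open>cl B = B\<close> still bounds the closure of the union.\<close>
    case (5 \<A> B)
    then have "cl (\<Union>\<A>) \<subseteq> cl B"
      by (intro cl_mono) (auto simp: theory_iff)
    with 5 show ?case
      by (simp add: theory_iff theory_module_simps)
  next
    case (4 \<A> A)
    then show ?case
      using cl_extensive[OF dom[OF 4(1)]] by (auto simp: theory_module_simps)
  qed (auto simp: theory_module_simps intro: cl_in_theories[OF dom])
  note Q_simps = subst_quantale_def powerset_quantale_def theory_module_simps
  have "quantale_module_axioms (subst_quantale (lang \<S>)) (theory_module \<S>)"
  proof (unfold_locales, goal_cases)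
    case (1 \<Sigma> \<Phi>)
    then show ?case
      by (simp add: Q_simps theory_iff cl_in_domain subst_act_in_domain)
  next
    case (2 \<Sigma> \<Sigma>' \<Phi>)
    then show ?case
      by (simp add: Q_simps theory_iff subst_act_mult cl_subst_act_cl subst_act_in_domain)
  next
    case (3 \<Phi>)
    then show ?case
      by (simp add: Q_simps theory_iff subst_act_one)
  next
    case (4 \<A> \<Phi>)
    then have "subst_act \<Sigma> \<Phi> \<subseteq> domain \<S>" if "\<Sigma> \<in> \<A>" for \<Sigma>
      using that by (intro subst_act_in_domain) (auto simp: Q_simps theory_iff)
    then show ?case
      by (simp add: Q_simps subst_act_Union_left cl_UN_cl)
  next
    case (5 \<Sigma> \<A>)
    then have \<Sigma>: "\<Sigma> \<subseteq> carrier (subst_monoid (lang \<S>))"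
      by (auto simp: Q_simps)
    have "subst_act \<Sigma> \<Phi> \<subseteq> domain \<S>" if "\<Phi> \<in> \<A>" for \<Phi>
      using that 5 \<Sigma> theory_iff by (intro subst_act_in_domain) blast+
    then show ?case
      using dom[OF 5(2)] \<Sigma>
      by (simp add: Q_simps cl_subst_act_cl subst_act_Union_right cl_UN_cl)
  qed
  with lattice show ?thesis
    by (intro quantale_module.intro quantale_subst_quantale)
qed

end


section \<open>Faithful interpretations\<close>

text \<open>Making the translation a parameter fixes one witness \<open>\<tau>\<close> for all
  results about \<open>\<iota>\<close>. The theorem interprets the locale twice, once in each
  direction.\<close>

locale interpreted_system = source: deductive_system \<S> + target: deductive_system \<T>
  for \<S> :: "'c system" and \<T> :: "'d system" +
  fixes \<iota> :: "'c sequent set \<Rightarrow> 'd sequent set" and \<tau> :: "'c formula \<Rightarrow> 'd formula"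
  assumes in_domain: "\<Phi> \<subseteq> domain \<S> \<Longrightarrow> \<iota> \<Phi> \<subseteq> domain \<T>"
    and preserves_Union: "\<A> \<subseteq> Pow (domain \<S>) \<Longrightarrow> \<iota> (\<Union>\<A>) = \<Union>(\<iota> ` \<A>)"
    and translation: "language_translation (lang \<S>) (lang \<T>) \<tau>"
    and entails_iff: "\<lbrakk>\<Phi> \<subseteq> domain \<S>; \<Psi> \<subseteq> domain \<S>\<rbrakk>
      \<Longrightarrow> entails \<S> \<Phi> \<Psi> \<longleftrightarrow> entails \<T> (\<iota> \<Phi>) (\<iota> \<Psi>)"
    and equivariant: "\<lbrakk>\<Phi> \<subseteq> domain \<S>; \<Sigma> \<subseteq> carrier (subst_monoid (lang \<S>))\<rbrakk>
      \<Longrightarrow> \<iota> (subst_act \<Sigma> \<Phi>) = subst_act (translate_substs \<tau> \<Sigma>) (\<iota> \<Phi>)"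

lemma faithful_interpretationE:
  assumes "faithful_interpretation \<S> \<T> \<iota>" and "deductive_system \<S>" and "deductive_system \<T>"
  obtains \<tau> where "interpreted_system \<S> \<T> \<iota> \<tau>"
proof -
  from assms(1) obtain \<tau> where \<iota>: "\<iota> \<in> Pow (domain \<S>) \<rightarrow> Pow (domain \<T>)"
    and Un: "\<forall>\<A> \<subseteq> Pow (domain \<S>). \<iota> (\<Union>\<A>) = \<Union>(\<iota> ` \<A>)"
    and \<tau>: "language_translation (lang \<S>) (lang \<T>) \<tau>"
    and iff: "\<forall>\<Phi> \<subseteq> domain \<S>. \<forall>\<Psi> \<subseteq> domain \<S>. entails \<S> \<Phi> \<Psi> \<longleftrightarrow> entails \<T> (\<iota> \<Phi>) (\<iota> \<Psi>)"
    and act: "\<forall>\<Phi> \<subseteq> domain \<S>. \<forall>\<Sigma> \<subseteq> carrier (subst_monoid (lang \<S>)).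
        \<iota> (subst_act \<Sigma> \<Phi>) = subst_act (translate_substs \<tau> \<Sigma>) (\<iota> \<Phi>)"
    unfolding faithful_interpretation_def by (elim conjE exE) (rule that)
  have "interpreted_system \<S> \<T> \<iota> \<tau>"
  proof (intro interpreted_system.intro interpreted_system_axioms.intro)
    show "\<iota> \<Phi> \<subseteq> domain \<T>" if "\<Phi> \<subseteq> domain \<S>" for \<Phi>
      using that \<iota> by auto
  qed (assumption | rule assms(2,3) \<tau> Un[rule_format] iff[rule_format] act[rule_format])+
  then show ?thesis
    by (rule that)
qed

context interpreted_system
begin

text \<open>The closure is taken because \<open>\<iota>\<close> need not send theories to
  theories.\<close>

definition theory_map where "theory_map \<Phi> = target.cl (\<iota> \<Phi>)"

text \<open>Equal closures mean interderivability, which \<open>\<iota>\<close> preserves and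
  reflects. Preservation makes \<open>theory_map\<close> independent of generators; reflection
  allows an outer interpretation to be cancelled.\<close>

lemma cl_eq_iff:
  assumes "\<Phi> \<subseteq> domain \<S>" and "\<Psi> \<subseteq> domain \<S>"
  shows "target.cl (\<iota> \<Phi>) = target.cl (\<iota> \<Psi>) \<longleftrightarrow> source.cl \<Phi> = source.cl \<Psi>"
  using assms by (simp add: target.cl_eq_iff source.cl_eq_iff in_domain entails_iff)

lemma theory_map_cl: "\<Phi> \<subseteq> domain \<S> \<Longrightarrow> theory_map (source.cl \<Phi>) = target.cl (\<iota> \<Phi>)"
  unfolding theory_map_def by (subst cl_eq_iff) (auto dest: subsetD[OF source.cl_in_domain])

lemma theory_map_in_theories:
  "\<Phi> \<subseteq> domain \<S> \<Longrightarrow> theory_map \<Phi> \<in> carrier (theory_module \<T>)"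
  unfolding theory_map_def by (intro target.cl_in_theories in_domain)

lemma translate_substs_closed:
  "\<Sigma> \<subseteq> carrier (subst_monoid (lang \<S>))
    \<Longrightarrow> translate_substs \<tau> \<Sigma> \<subseteq> carrier (subst_monoid (lang \<T>))"
  using language_translation_in_Fm[OF translation]
  by (fastforce simp: translate_substs_def carrier_subst_monoid)

text \<open>By \<open>theory_map_cl\<close> the map can be evaluated on generators, where
  \<open>\<iota>\<close> preserves unions and is equivariant; the closures are then restored inside
  the union or the action.\<close>

lemma theory_module_hom:
  "quantale_module_hom (subst_quantale (lang \<S>)) (theory_module \<S>)
    (restrict_scalars (translate_substs \<tau>) (theory_module \<T>)) theory_map"
proof -
  have "quantale_module_hom_axioms (subst_quantale (lang \<S>)) (theory_module \<S>)
    (restrict_scalars (translate_substs \<tau>) (theory_module \<T>)) theory_map"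
  proof (unfold_locales, goal_cases)
    case 1
    show ?case
      using theory_map_in_theories by (auto simp: restrict_scalars_simps source.theory_iff)
  next
    case (2 \<A>)
    then have \<A>: "\<A> \<subseteq> Pow (domain \<S>)"
      using source.theory_iff by blast
    then have "\<Union>\<A> \<subseteq> domain \<S>"
      by auto
    then have "theory_map (source.cl (\<Union>\<A>)) = target.cl (\<Union>\<Phi>\<in>\<A>. \<iota> \<Phi>)"
      using \<A> by (simp add: theory_map_cl preserves_Union)
    also have "\<dots> = target.cl (\<Union>\<Phi>\<in>\<A>. theory_map \<Phi>)"
      using \<A> in_domain unfolding theory_map_def by (intro target.cl_UN_cl[symmetric]) blast
    finally show ?case
      by (simp add: restrict_scalars_simps source.theory_module_simps target.theory_module_simps)
  next
    case (3 \<Sigma> \<Phi>)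
    then have \<Sigma>: "\<Sigma> \<subseteq> carrier (subst_monoid (lang \<S>))" and \<Phi>: "\<Phi> \<subseteq> domain \<S>"
      by (auto simp: subst_quantale_def powerset_quantale_def source.theory_iff)
    have "theory_map (source.cl (subst_act \<Sigma> \<Phi>))
        = target.cl (subst_act (translate_substs \<tau> \<Sigma>) (\<iota> \<Phi>))"
      using \<Sigma> \<Phi> by (simp add: theory_map_cl source.subst_act_in_domain equivariant)
    also have "\<dots> = target.cl (subst_act (translate_substs \<tau> \<Sigma>) (theory_map \<Phi>))"
      unfolding theory_map_def using \<Sigma> \<Phi>
      by (simp add: target.cl_subst_act_cl translate_substs_closed in_domain)
    finally show ?case
      by (simp add: restrict_scalars_simps source.theory_module_simps target.theory_module_simps)
  qed
  then show ?thesis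
    using quantale_module_restrict_scalars[OF quantale_hom_translate_substs[OF translation]
        target.quantale_module_theory_module] source.quantale_module_theory_module
    by (intro quantale_module_hom.intro)
qed

end

section \<open>Isomorphism of the theory modules over both substitution quantales\<close>

theorem theorem5p5p8:
  fixes \<S> :: "'c system" and \<T> :: "'d system"
  assumes "deductive_system \<S>" and "deductive_system \<T>"
    and "equivalent_systems \<S> \<T>"
  shows "\<exists>\<tau> \<tau>'.
    language_translation (lang \<S>) (lang \<T>) \<tau> \<and>
    language_translation (lang \<T>) (lang \<S>) \<tau>' \<and>
    quantale_hom (subst_quantale (lang \<S>)) (subst_quantale (lang \<T>)) (translate_substs \<tau>) \<and>
    quantale_hom (subst_quantale (lang \<T>)) (subst_quantale (lang \<S>)) (translate_substs \<tau>') \<and>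
    modules_isomorphic (subst_quantale (lang \<S>))
      (theory_module \<S>) (restrict_scalars (translate_substs \<tau>) (theory_module \<T>)) \<and>
    modules_isomorphic (subst_quantale (lang \<T>))
      (restrict_scalars (translate_substs \<tau>') (theory_module \<S>)) (theory_module \<T>)"
proof -
  obtain \<iota> \<iota>' where "faithful_interpretation \<S> \<T> \<iota>" "faithful_interpretation \<T> \<S> \<iota>'"
    and interderivable:
      "\<And>\<Phi>. \<Phi> \<subseteq> domain \<S> \<Longrightarrow> entails \<S> \<Phi> (\<iota>' (\<iota> \<Phi>)) \<and> entails \<S> (\<iota>' (\<iota> \<Phi>)) \<Phi>"
    using assms(3) unfolding equivalent_systems_def by blast
  then obtain \<tau> \<tau>' where "interpreted_system \<S> \<T> \<iota> \<tau>" and "interpreted_system \<T> \<S> \<iota>' \<tau>'"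
    using assms(1,2) by (meson faithful_interpretationE)
  then interpret I: interpreted_system \<S> \<T> \<iota> \<tau> + I': interpreted_system \<T> \<S> \<iota>' \<tau>'
    by simp_all
  have left: "I.source.cl (\<iota>' (\<iota> \<Phi>)) = I.source.cl \<Phi>" if "\<Phi> \<subseteq> domain \<S>" for \<Phi>
    using that interderivable by (simp add: I.source.cl_eq_iff I.in_domain I'.in_domain)
  \<comment> \<open>Here \<open>left\<close> is taken at \<open>\<iota>' \<Psi>\<close>, and
    \<open>I'.cl_eq_iff\<close> cancels the outermost \<open>\<iota>'\<close> on both sides.\<close>
  have right: "I.target.cl (\<iota> (\<iota>' \<Psi>)) = I.target.cl \<Psi>" if "\<Psi> \<subseteq> domain \<T>" for \<Psi>
    using left[OF I'.in_domain[OF that]] that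
    by (simp add: I'.cl_eq_iff I.in_domain I'.in_domain)
  \<comment> \<open>The inner closure is absorbed by \<open>I'.theory_map_cl\<close>, so
    \<open>left\<close> applies and yields \<open>cl \<Phi>\<close>, which is \<open>\<Phi>\<close>
    for a theory.\<close>
  have inv: "I'.theory_map (I.theory_map \<Phi>) = \<Phi>" if "\<Phi> \<in> carrier (theory_module \<S>)" for \<Phi>
    using that left unfolding I.theory_map_def
    by (simp add: I'.theory_map_cl I.in_domain I.source.theory_iff)
  have inv': "I.theory_map (I'.theory_map \<Psi>) = \<Psi>" if "\<Psi> \<in> carrier (theory_module \<T>)" for \<Psi>
    using that right unfolding I'.theory_map_def
    by (simp add: I.theory_map_cl I'.in_domain I.target.theory_iff)
  have maps: "I.theory_map \<in> carrier (theory_module \<S>) \<rightarrow> carrier (theory_module \<T>)"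
    "I'.theory_map \<in> carrier (theory_module \<T>) \<rightarrow> carrier (theory_module \<S>)"
    using I.theory_map_in_theories I'.theory_map_in_theories
    by (auto simp: I.source.theory_iff I.target.theory_iff)
  then have bij: "bij_betw I.theory_map (carrier (theory_module \<S>)) (carrier (theory_module \<T>))"
    using inv inv' by (rule bij_betwI)
  \<comment> \<open>Linearity over the second language is known for \<open>I'.theory_map\<close>; it
    passes to its inverse \<open>I.theory_map\<close>.\<close>
  have "quantale_module_hom (subst_quantale (lang \<T>))
      (restrict_scalars (translate_substs \<tau>') (theory_module \<S>)) (theory_module \<T>) I.theory_map"
    using I'.theory_module_hom
    by (rule quantale_module_hom_inverse) (use maps inv inv' in \<open>auto simp: restrict_scalars_simps\<close>)
  then have "modules_isomorphic (subst_quantale (lang \<T>))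
      (restrict_scalars (translate_substs \<tau>') (theory_module \<S>)) (theory_module \<T>)"
    using bij unfolding modules_isomorphic_def
    by (intro exI[of _ I.theory_map]) (simp add: restrict_scalars_simps)
  moreover have "modules_isomorphic (subst_quantale (lang \<S>))
      (theory_module \<S>) (restrict_scalars (translate_substs \<tau>) (theory_module \<T>))"
    using bij I.theory_module_hom unfolding modules_isomorphic_def
    by (intro exI[of _ I.theory_map]) (simp add: restrict_scalars_simps)
  ultimately show ?thesis
    using I.translation I'.translation
    by (intro exI[of _ \<tau>] exI[of _ \<tau>'] conjI quantale_hom_translate_substs) assumption+
qed

end
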